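(* Let $P_1,\ldots,P_N$ be discrete probability measures on $\mathbb{R}^d$. Let $\Pi(P_1,\ldots,P_N)$ denote the set of all coupled random vectors $(X_1,\ldots,X_N)$ with marginals $X_i\sim P_i$, and let $\overline{X}=\frac{X_1+\cdots+X_N}{N}$ denote the coordinate average. Let $$S=\left\{\frac{x_1+\cdots+x_N}{N}\;\Big|\; x_i\in\operatorname{supp}(P_i),\ i=1,\ldots,N\right\}.$$ Then: (i) There exists $(X_1^o,\ldots,X_N^o)\in\Pi(P_1,\ldots,P_N)$ such that $$E\bigl|\overline{X^o}\bigr|^2=\sup_{(X_1,\ldots,X_N)\in\Pi(P_1,\ldots,P_N)}E\bigl|\overline{X}\bigr|^2. \qquad ( * )$$ (ii) Any $(X_1^o,\ldots,X_N^o)\in\Pi(P_1,\ldots,P_N)$ which satisfies $( * )$ has $\operatorname{supp}(\mathcal{L}\overline{X^o})\subseteq S$ and $$\sum_{i=1}^N W_2\bigl(\mathcal{L}\overline{X^o},P_i\bigr)^2=\inf_{P\in\mathcal{P}^2(\mathbb{R}^d)}\sum_{i=1}^N W_2(P,P_i)^2=\inf_{P\in\mathcal{P}^2_{S}(\mathbb{R}^d)}\sum_{i=1}^N W_2(P,P_i)^2,$$ where $\mathcal{L}\overline{X^o}$ denotes the distribution (law) of $\overline{X^o}$. (iii) Any $\bar{P}\in\arg\min_{P\in\mathcal{P}^2(\mathbb{R}^d)}\sum_{i=1}^N W_2(P,P_i)^2$ satisfies $\operatorname{supp}(\bar{P})\subseteq S$.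
   Context: A discrete probability measure on $\mathbb{R}^d$ is a probability measure with finite support. $\mathcal{P}^2(\mathbb{R}^d)$ is the set of all probability measures on $\mathbb{R}^d$ with finite second moments, and $\mathcal{P}^2_{S}(\mathbb{R}^d)=\{P\in\mathcal{P}^2(\mathbb{R}^d)\mid \operatorname{supp}(P)\subseteq S\}$. $W_2$ is the quadratic Wasserstein distance: $W_2(P,Q)^2=\inf E|X-Y|^2$ over all couplings $(X,Y)$ with $X\sim P$, $Y\sim Q$, where $|\cdot|$ is the Euclidean norm. For a random vector $(X_1^o,\ldots,X_N^o)$, $\overline{X^o}=\frac{1}{N}\sum_{i=1}^N X_i^o$. *)

theory Defs
  imports "HOL-Probability.Probability"
begin

(* A probability measure on a space 'a is a measure on the Borel sigma-algebra of that type. *)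
definition prob_measures :: "'a::topological_space measure set" where
  "prob_measures = {P. prob_space P \<and> sets P = sets borel}"

definition supp :: "'a::topological_space measure \<Rightarrow> 'a set" where
  "supp P = {x. \<forall>U. open U \<longrightarrow> x \<in> U \<longrightarrow> measure P U > 0}"

definition discrete_measure :: "'a::topological_space measure \<Rightarrow> bool" where
  "discrete_measure P \<longleftrightarrow> P \<in> prob_measures \<and> finite (supp P)"

definition P2 :: "'a::euclidean_space measure set" where
  "P2 = {P \<in> prob_measures. integrable P (\<lambda>x. (norm x)\<^sup>2)}"

definition P2_on :: "'a::euclidean_space set \<Rightarrow> 'a measure set" where
  "P2_on S = {P \<in> P2. supp P \<subseteq> S}"

(* Couplings of two measures, given as joint laws of pairs (X, Y). *)
definition couplings2 ::
    "'a::euclidean_space measure \<Rightarrow> 'a measure \<Rightarrow> ('a \<times> 'a) measure set" where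
  "couplings2 P Q = {\<gamma>. prob_space \<gamma> \<and> sets \<gamma> = sets (borel \<Otimes>\<^sub>M borel) \<and>
     distr \<gamma> borel fst = P \<and> distr \<gamma> borel snd = Q}"

(* Meant for P and Q in P2: the integrand is then integrable under every coupling and the
   infimum is over a nonempty set of nonnegative reals, so no default values arise. *)
definition W2 :: "'a::euclidean_space measure \<Rightarrow> 'a measure \<Rightarrow> real" where
  "W2 P Q = sqrt (INF \<gamma> \<in> couplings2 P Q. \<integral>z. (norm (fst z - snd z))\<^sup>2 \<partial>\<gamma>)"

(* (X 1, ..., X N) is a random vector, defined on the probability space M, with X i ~ P i. *)
definition coupled_vector ::
    "nat \<Rightarrow> (nat \<Rightarrow> 'a::euclidean_space measure) \<Rightarrow> 'w measure \<Rightarrow> (nat \<Rightarrow> 'w \<Rightarrow> 'a) \<Rightarrow> bool" where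
  "coupled_vector N P M X \<longleftrightarrow> prob_space M \<and>
     (\<forall>i\<in>{1..N}. X i \<in> borel_measurable M \<and> distr M borel (X i) = P i)"

definition avg :: "nat \<Rightarrow> (nat \<Rightarrow> 'a::real_vector) \<Rightarrow> 'a" where
  "avg N x = (1 / real N) *\<^sub>R (\<Sum>i\<in>{1..N}. x i)"

definition mean_vector :: "nat \<Rightarrow> (nat \<Rightarrow> 'w \<Rightarrow> 'a::real_vector) \<Rightarrow> 'w \<Rightarrow> 'a" where
  "mean_vector N X = (\<lambda>\<omega>. avg N (\<lambda>i. X i \<omega>))"

definition mean_law ::
    "nat \<Rightarrow> 'w measure \<Rightarrow> (nat \<Rightarrow> 'w \<Rightarrow> 'a::euclidean_space) \<Rightarrow> 'a measure" where
  "mean_law N M X = distr M borel (mean_vector N X)"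

definition mean_moment ::
    "nat \<Rightarrow> 'w measure \<Rightarrow> (nat \<Rightarrow> 'w \<Rightarrow> 'a::euclidean_space) \<Rightarrow> real" where
  "mean_moment N M X = (\<integral>\<omega>. (norm (mean_vector N X \<omega>))\<^sup>2 \<partial>M)"

(* The supremum over all coupled random vectors. A set cannot range over sample spaces of all
   types; sample spaces of type nat => 'a suffice, since they carry every joint law: see
   coupled_vector_canonical below. For finitely supported P i the average is almost surely
   bounded, so the integrals exist and the supremum is over a bounded nonempty set. *)
definition sup_mean_moment :: "nat \<Rightarrow> (nat \<Rightarrow> 'a::euclidean_space measure) \<Rightarrow> real" where
  "sup_mean_moment N P =
     Sup {mean_moment N M X | (M :: (nat \<Rightarrow> 'a) measure) X. coupled_vector N P M X}"

definition averages :: "nat \<Rightarrow> (nat \<Rightarrow> 'a::euclidean_space measure) \<Rightarrow> 'a set" where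
  "averages N P = {avg N x | x. \<forall>i\<in>{1..N}. x i \<in> supp (P i)}"

lemma coupled_vector_canonical:
  fixes P :: "nat \<Rightarrow> 'a::euclidean_space measure" and M :: "'w measure"
  assumes "coupled_vector N P M X"
  defines "M' \<equiv> distr M (\<Pi>\<^sub>M i\<in>{1..N}. borel) (\<lambda>\<omega>. \<lambda>i\<in>{1..N}. X i \<omega>)"
  defines "X' \<equiv> \<lambda>i x. x i"
  shows "coupled_vector N P M' X'" and "mean_law N M' X' = mean_law N M X"
    and "mean_moment N M' X' = mean_moment N M X"
proof -
  interpret prob_space M using assms(1) by (simp add: coupled_vector_def)
  have X [measurable]: "X i \<in> borel_measurable M" if "i \<in> {1..N}" for i
    using assms(1) that by (simp add: coupled_vector_def)
  have J [measurable]: "(\<lambda>\<omega>. \<lambda>i\<in>{1..N}. X i \<omega>) \<in> measurable M (\<Pi>\<^sub>M i\<in>{1..N}. borel)"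
    by (intro measurable_restrict X)
  have C [measurable]: "X' i \<in> borel_measurable (\<Pi>\<^sub>M i\<in>{1..N}. borel)" if "i \<in> {1..N}" for i
    unfolding X'_def using that by measurable
  have mean [measurable]: "mean_vector N X' \<in> borel_measurable (\<Pi>\<^sub>M i\<in>{1..N}. borel)"
    unfolding mean_vector_def avg_def by (intro borel_measurable_scaleR borel_measurable_sum C) auto
  have eq: "mean_vector N X' (\<lambda>i\<in>{1..N}. X i \<omega>) = mean_vector N X \<omega>" for \<omega>
    by (simp add: mean_vector_def avg_def X'_def)
  have "distr M' borel (X' i) = P i" if "i \<in> {1..N}" for i
  proof -
    have "distr M' borel (X' i) = distr M borel (X i)"
      unfolding M'_def by (subst distr_distr[OF C[OF that] J]) (use that in \<open>simp add: comp_def X'_def\<close>)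
    then show ?thesis using assms(1) that by (simp add: coupled_vector_def)
  qed
  moreover have "prob_space M'" unfolding M'_def by (rule prob_space_distr[OF J])
  ultimately show "coupled_vector N P M' X'"
    using C by (simp add: coupled_vector_def M'_def)
  show "mean_law N M' X' = mean_law N M X"
    unfolding mean_law_def M'_def by (subst distr_distr[OF mean J]) (simp add: comp_def eq del: One_nat_def)
  show "mean_moment N M' X' = mean_moment N M X"
    unfolding mean_moment_def M'_def by (subst integral_distr[OF J]) (use mean in \<open>auto simp: eq simp del: One_nat_def\<close>)
qed

end

theory Submission
  imports Defs
begin

text \<open>
  Write \<open>Xbar\<close> for the average of \<open>X\<^sub>1, \<dots>, X\<^sub>N\<close>, and \<open>S\<close> for the finite set of averages
  of support points. Everything rests on the identity
  \<open>\<Sum>\<^sub>i |y - x\<^sub>i|\<^sup>2 = N |y - xbar|\<^sup>2 + \<Sum>\<^sub>i |x\<^sub>i|\<^sup>2 - N |xbar|\<^sup>2\<close> (\<open>sum_norm_diff_avg\<close>). The sum of the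
  expectations \<open>E|X\<^sub>i|\<^sup>2\<close> depends only on the marginals; call it \<open>C\<close>. Taking expectations with
  \<open>y = Xbar\<close>, the law of \<open>Xbar\<close> has total cost at most \<open>C - N E|Xbar|\<^sup>2\<close>, for the couplings
  \<open>(Xbar, X\<^sub>i)\<close>. Conversely, if couplings of a measure \<open>Q\<close> with the \<open>P\<^sub>i\<close> are glued
  along \<open>Q\<close> to one vector \<open>(Y, X\<^sub>1, \<dots>, X\<^sub>N)\<close>, their costs add up to
  \<open>N E|Y - Xbar|\<^sup>2 + C - N E|Xbar|\<^sup>2\<close>, hence to at least \<open>N E dist(Y, S)\<^sup>2 + C - N m\<close>, where
  \<open>m\<close> is the supremum of the moments \<open>E|Xbar|\<^sup>2\<close>. So the minimal total cost is \<open>C - N m\<close>, it is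
  attained by the law of every optimal average, and it forces \<open>dist(Y, S) = 0\<close> almost surely: every
  minimiser is supported in \<open>S\<close>. The term with the distance survives the passage to infima over
  couplings, so optimal couplings of \<open>Q\<close> and \<open>P\<^sub>i\<close> need not be shown to exist.

  The moments \<open>E|Xbar|\<^sup>2\<close> depend only on the joint law of \<open>X\<close>. This law lives on the finite set of
  tuples of support points, so it is a vector of weights satisfying finitely many linear marginal
  constraints. These weights form a compact set on which the moment is continuous, which gives
  the existence of an optimal vector (\<open>sup_mean_moment_attained\<close>).

  Gluing uses the finiteness of the supports as well: a coupling of \<open>Q\<close> with \<open>P\<^sub>i\<close> is described by
  functions \<open>f\<^sub>i\<close>, where \<open>f\<^sub>i a y\<close> is the conditional probability of the atom \<open>a\<close> given \<open>Y = y\<close>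
  (\<open>discrete_disintegration\<close>). Making \<open>X\<^sub>1, \<dots>, X\<^sub>N\<close> conditionally independent given \<open>Y\<close>, the tuple
  \<open>x\<close> has conditional probability \<open>\<Prod>\<^sub>i f\<^sub>i (x\<^sub>i) y\<close>, and all expectations become finite sums of
  integrals over \<open>Q\<close> (\<open>coupling_costs_lower_bound\<close>).
\<close>

section \<open>Supports and discrete measures\<close>

text \<open>
  The complement of the support is covered by its null open neighbourhoods, and by second
  countability countably many null basis sets suffice.
\<close>
lemma AE_in_supp:
  fixes P :: "'a::second_countable_topology measure"
  assumes "P \<in> prob_measures"
  shows "AE x in P. x \<in> supp P"
proof -
  interpret prob_space P using assms by (simp add: prob_measures_def)
  have sets: "sets P = sets borel" using assms by (simp add: prob_measures_def)
  obtain B :: "'a set set" where B: "countable B" "topological_basis B"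
    using ex_countable_basis by blast
  let ?N = "{U \<in> B. measure P U = 0}"
  have "\<Union> ?N \<in> null_sets P"
  proof (rule null_sets_UN'[of ?N "\<lambda>U. U" P, simplified])
    show "countable {U \<in> B. prob U = 0}" using B(1) by simp
    fix U assume "U \<in> B \<and> prob U = 0"
    then show "U \<in> null_sets P"
      using topological_basis_open[OF B(2)] by (auto simp: null_sets_def sets emeasure_eq_measure)
  qed
  moreover have "- supp P \<subseteq> \<Union> ?N"
  proof
    fix x assume "x \<in> - supp P"
    then obtain U where U: "open U" "x \<in> U" "measure P U = 0"
      by (auto simp: supp_def) (metis measure_nonneg order.order_iff_strict)
    obtain V where V: "V \<in> B" "x \<in> V" "V \<subseteq> U"
      using topological_basisE[OF B(2) U(1,2)] by blast
    have "measure P V \<le> measure P U"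
      using V U by (intro finite_measure_mono) (auto simp: sets)
    then show "x \<in> \<Union> ?N" using U V by (auto simp: measure_le_0_iff)
  qed
  ultimately show ?thesis by (intro AE_I'[of "\<Union> ?N"]) auto
qed

lemma supp_subset_closed:
  assumes "P \<in> prob_measures" "closed S" "AE x in P. x \<in> S"
  shows "supp P \<subseteq> S"
proof
  fix x assume x: "x \<in> supp P"
  have sets: "sets P = sets borel" using assms by (simp add: prob_measures_def)
  have "emeasure P (- S) = 0"
    using assms(2,3) by (subst (asm) AE_iff_measurable[of "-S"]) (auto simp: sets sets_eq_imp_space_eq[OF sets])
  then have "measure P (- S) = 0" by (simp add: measure_def)
  then show "x \<in> S"
    using x assms(2) unfolding supp_def by (metis (mono_tags, lifting) ComplI less_irrefl mem_Collect_eq open_Compl)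
qed

lemma discrete_measure_eq_sum_singleton:
  fixes P :: "'a::{second_countable_topology, t1_space} measure"
  assumes "discrete_measure P" "A \<in> sets borel"
  shows "measure P A = (\<Sum>a\<in>supp P \<inter> A. measure P {a})"
proof -
  have P: "P \<in> prob_measures" "finite (supp P)" using assms by (auto simp: discrete_measure_def)
  interpret prob_space P using P by (simp add: prob_measures_def)
  have sets: "sets P = sets borel" using P by (simp add: prob_measures_def)
  have fin: "finite (supp P \<inter> A)" using P by auto
  have "measure P A = measure P (supp P \<inter> A)"
    using AE_in_supp[OF P(1)] assms(2) fin
    by (intro finite_measure_eq_AE) (auto simp: sets intro: borel_closed finite_imp_closed)
  also have "\<dots> = (\<Sum>a\<in>supp P \<inter> A. measure P {a})"
    using fin by (intro finite_measure_eq_sum_singleton) (auto simp: sets)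
  finally show ?thesis .
qed

lemma discrete_measure_sum_singletons:
  fixes P :: "'a::{second_countable_topology, t1_space} measure"
  assumes "discrete_measure P"
  shows "(\<Sum>a\<in>supp P. measure P {a}) = 1"
proof -
  interpret prob_space P using assms by (simp add: discrete_measure_def prob_measures_def)
  have "space P = UNIV"
    using assms by (auto simp: discrete_measure_def prob_measures_def dest: sets_eq_imp_space_eq)
  then show ?thesis
    using discrete_measure_eq_sum_singleton[OF assms, of UNIV] prob_space by simp
qed

section \<open>Couplings and the Wasserstein distance\<close>

text \<open>The product measure is a coupling.\<close>
lemma couplings2_nonempty:
  assumes "Q \<in> prob_measures" "R \<in> prob_measures"
  shows "couplings2 Q R \<noteq> {}"
proof -
  interpret Q: prob_space Q using assms by (simp add: prob_measures_def)
  interpret R: prob_space R using assms by (simp add: prob_measures_def)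
  interpret pair_prob_space Q R ..
  have sets [measurable_cong]: "sets Q = sets borel" "sets R = sets borel"
    using assms by (auto simp: prob_measures_def)
  have "sets (Q \<Otimes>\<^sub>M R) = sets (borel \<Otimes>\<^sub>M borel)" by (intro sets_pair_measure_cong sets)
  moreover have "distr (Q \<Otimes>\<^sub>M R) borel fst = Q"
    using R.distr_pair_fst[of Q] by (simp cong: distr_cong add: sets)
  moreover have "distr (Q \<Otimes>\<^sub>M R) borel snd = R"
  proof (rule measure_eqI)
    fix A assume "A \<in> sets (distr (Q \<Otimes>\<^sub>M R) borel snd)"
    then have A: "A \<in> sets borel" by simp
    have "emeasure (distr (Q \<Otimes>\<^sub>M R) borel snd) A = emeasure (Q \<Otimes>\<^sub>M R) (space Q \<times> A)"
      using A sets_eq_imp_space_eq[OF sets(2)]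
      by (subst emeasure_distr) (auto intro!: arg_cong[where f="emeasure _"] simp: space_pair_measure)
    also have "\<dots> = emeasure Q (space Q) * emeasure R A"
      using A by (intro R.emeasure_pair_measure_Times sets.top) (simp add: sets)
    also have "\<dots> = emeasure R A" by (simp add: Q.emeasure_space_1)
    finally show "emeasure (distr (Q \<Otimes>\<^sub>M R) borel snd) A = emeasure R A" .
  qed (simp add: sets)
  ultimately have "Q \<Otimes>\<^sub>M R \<in> couplings2 Q R" by (simp add: couplings2_def prob_space_axioms)
  then show ?thesis by blast
qed

text \<open>
  The square root of a negative real is defined, and so is the infimum of the empty set; the
  nonemptiness of the set of couplings is what makes the infimum nonnegative here.
\<close>
lemma W2_squared:
  assumes "Q \<in> prob_measures" "R \<in> prob_measures"
  shows "(W2 Q R)\<^sup>2 = (INF \<gamma> \<in> couplings2 Q R. \<integral>z. (norm (fst z - snd z))\<^sup>2 \<partial>\<gamma>)"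
  unfolding W2_def using couplings2_nonempty[OF assms]
  by (intro real_sqrt_pow2 cINF_greatest) auto

lemma W2_squared_le:
  assumes "Q \<in> prob_measures" "R \<in> prob_measures" "\<gamma> \<in> couplings2 Q R"
  shows "(W2 Q R)\<^sup>2 \<le> (\<integral>z. (norm (fst z - snd z))\<^sup>2 \<partial>\<gamma>)"
  unfolding W2_squared[OF assms(1,2)] using assms(3)
  by (intro cINF_lower bdd_belowI2[where m=0]) auto

lemma AE_coupling_snd_in_supp:
  assumes R: "discrete_measure R" and \<gamma>: "\<gamma> \<in> couplings2 Q R"
  shows "AE z in \<gamma>. snd z \<in> supp R"
proof -
  have sets [measurable_cong]: "sets \<gamma> = sets (borel \<Otimes>\<^sub>M borel)" and "distr \<gamma> borel snd = R"
    using \<gamma> by (auto simp: couplings2_def)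
  then have "AE x in distr \<gamma> borel snd. x \<in> supp R"
    using R AE_in_supp by (auto simp: discrete_measure_def)
  then show ?thesis
    using R by (subst (asm) AE_distr_iff)
      (auto simp: discrete_measure_def intro: borel_closed finite_imp_closed)
qed

text \<open>
  Disintegration of a coupling along its first marginal, when the second one has finitely many
  atoms: \<open>f a y\<close> is the conditional probability that the second coordinate is \<open>a\<close>, given that
  the first one is \<open>y\<close>. For fixed \<open>a\<close>, it is the Radon-Nikodym derivative with respect to \<open>Q\<close> of
  the measure \<open>A \<mapsto> \<gamma> (A \<times> {a})\<close>. These measures add up to \<open>Q\<close>, so the derivatives add up to 1.
\<close>
lemma discrete_disintegration:
  fixes Q R :: "'a::euclidean_space measure"
  assumes Q: "Q \<in> prob_measures" and R: "discrete_measure R" and \<gamma>: "\<gamma> \<in> couplings2 Q R"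
  shows "\<exists>f :: 'a \<Rightarrow> 'a \<Rightarrow> real.
    (\<forall>a. f a \<in> borel_measurable borel) \<and> (\<forall>a y. 0 \<le> f a y) \<and> (\<forall>y. (\<Sum>a\<in>supp R. f a y) = 1) \<and>
    (\<forall>a\<in>supp R. \<forall>h :: 'a \<Rightarrow> real. h \<in> borel_measurable borel \<longrightarrow>
       (\<integral>z. indicator {a} (snd z) * h (fst z) \<partial>\<gamma>) = (\<integral>y. f a y * h y \<partial>Q))"
proof -
  interpret Q: prob_space Q using Q by (simp add: prob_measures_def)
  interpret \<gamma>: prob_space \<gamma> using \<gamma> by (simp add: couplings2_def)
  have setsQ [measurable_cong]: "sets Q = sets borel" using Q by (simp add: prob_measures_def)
  have sets\<gamma> [measurable_cong]: "sets \<gamma> = sets (borel \<Otimes>\<^sub>M borel)"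
    and fst: "distr \<gamma> borel fst = Q" using \<gamma> by (auto simp: couplings2_def)
  have space\<gamma>: "space \<gamma> = UNIV" using sets_eq_imp_space_eq[OF sets\<gamma>] by (simp add: space_pair_measure)
  have fin: "finite (supp R)" using R by (simp add: discrete_measure_def)
  define \<nu> where "\<nu> a = distr (density \<gamma> (\<lambda>z. indicator {a} (snd z))) borel fst" for a
  have sets\<nu>: "sets (\<nu> a) = sets Q" for a by (simp add: \<nu>_def setsQ)
  have vimage: "fst -` A \<in> sets \<gamma>" if [measurable]: "A \<in> sets borel" for A :: "'a set"
    using measurable_sets[of fst \<gamma> borel A] by (simp add: space\<gamma>)
  have \<nu>: "emeasure (\<nu> a) A = emeasure \<gamma> (A \<times> {a})" if [measurable]: "A \<in> sets borel" for a A
  proof -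
    have "emeasure (\<nu> a) A = (\<integral>\<^sup>+z. indicator {a} (snd z) * indicator (fst -` A) z \<partial>\<gamma>)"
      unfolding \<nu>_def by (simp add: emeasure_distr emeasure_density space\<gamma> vimage)
    also have "\<dots> = (\<integral>\<^sup>+z. indicator (A \<times> {a}) z \<partial>\<gamma>)"
      by (intro nn_integral_cong) (auto simp: indicator_def)
    also have "\<dots> = emeasure \<gamma> (A \<times> {a})" by (intro nn_integral_indicator) (simp add: sets\<gamma>)
    finally show ?thesis .
  qed
  have fstA: "emeasure Q A = emeasure \<gamma> (fst -` A)" if "A \<in> sets borel" for A
    using that by (subst fst[symmetric]) (simp add: emeasure_distr space\<gamma>)
  have ac: "absolutely_continuous Q (\<nu> a)" for a
    unfolding absolutely_continuous_def
  proof
    fix A assume A: "A \<in> null_sets Q"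
    then have Ab: "A \<in> sets borel" using setsQ by auto
    have "emeasure \<gamma> (A \<times> {a}) \<le> emeasure \<gamma> (fst -` A)"
      using vimage[OF Ab] by (intro emeasure_mono) auto
    then show "A \<in> null_sets (\<nu> a)"
      using A Ab by (auto simp: null_sets_def \<nu> sets\<nu> fstA)
  qed
  have finite\<nu>: "finite_measure (\<nu> a)" for a
    by (rule finite_measureI) (simp add: \<nu>_def[of a] \<nu>[of UNIV a, unfolded \<nu>_def])
  have "\<exists>D. D \<in> borel_measurable Q \<and> (AE x in Q. RN_deriv Q (\<nu> a) x = ennreal (D x)) \<and> (\<forall>x. 0 \<le> D x)" for a
    using Q.real_RN_deriv[OF finite\<nu> ac sets\<nu>] by metis
  then obtain D where D: "\<And>a. D a \<in> borel_measurable Q"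
    "\<And>a. AE x in Q. RN_deriv Q (\<nu> a) x = ennreal (D a x)" "\<And>a x. 0 \<le> D a x"
    by metis
  note D(1) [measurable]
  have ennreal_sum: "ennreal (\<Sum>a\<in>supp R. D a y) = (\<Sum>a\<in>supp R. ennreal (D a y))" for y
    using D(3) by (subst sum_ennreal) auto
  have densD: "density Q (\<lambda>x. ennreal (D a x)) = \<nu> a" for a
  proof -
    have "density Q (RN_deriv Q (\<nu> a)) = \<nu> a" by (rule Q.density_RN_deriv[OF ac sets\<nu>])
    moreover have "density Q (\<lambda>x. ennreal (D a x)) = density Q (RN_deriv Q (\<nu> a))"
    proof (rule density_cong)
      show "AE x in Q. ennreal (D a x) = RN_deriv Q (\<nu> a) x" using D(2)[of a] by eventually_elim simp
    qed auto
    ultimately show ?thesis by simp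
  qed
  have "AE y in Q. ennreal (\<Sum>a\<in>supp R. D a y) = 1"
  proof (rule Q.density_unique)
    show "density Q (\<lambda>y. ennreal (\<Sum>a\<in>supp R. D a y)) = density Q (\<lambda>_. 1)"
    proof (rule measure_eqI)
      fix A assume "A \<in> sets (density Q (\<lambda>y. ennreal (\<Sum>a\<in>supp R. D a y)))"
      then have A [measurable]: "A \<in> sets borel" by (simp add: setsQ)
      have "emeasure (density Q (\<lambda>y. ennreal (\<Sum>a\<in>supp R. D a y))) A
          = (\<integral>\<^sup>+y. (\<Sum>a\<in>supp R. ennreal (D a y) * indicator A y) \<partial>Q)"
        by (subst emeasure_density) (auto simp: setsQ ennreal_sum sum_distrib_right[symmetric])
      also have "\<dots> = (\<Sum>a\<in>supp R. emeasure (density Q (\<lambda>y. ennreal (D a y))) A)"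
        by (subst nn_integral_sum) (auto simp: emeasure_density setsQ)
      also have "\<dots> = (\<Sum>a\<in>supp R. emeasure \<gamma> (A \<times> {a}))" by (simp add: densD \<nu>)
      also have "\<dots> = emeasure \<gamma> (\<Union>a\<in>supp R. A \<times> {a})"
        using fin by (intro sum_emeasure) (auto simp: disjoint_family_on_def sets\<gamma>)
      also have "\<dots> = emeasure \<gamma> (fst -` A)"
        using AE_coupling_snd_in_supp[OF R \<gamma>] vimage[OF A] fin
        by (intro emeasure_eq_AE) (auto simp: sets\<gamma> intro!: sets.finite_UN)
      finally show "emeasure (density Q (\<lambda>y. ennreal (\<Sum>a\<in>supp R. D a y))) A = emeasure (density Q (\<lambda>_. 1)) A"
        by (simp add: density_1 fstA)
    qed simp
  qed auto
  then have one: "AE y in Q. (\<Sum>a\<in>supp R. D a y) = 1"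
    by eventually_elim (simp add: ennreal_eq_1)
  \<comment> \<open>The derivatives sum to 1 only almost everywhere. On the exceptional null set they are replaced
    by the point mass at an arbitrary atom, so that later identities hold for every \<open>y\<close>.\<close>
  obtain a0 where a0: "a0 \<in> supp R"
    using discrete_measure_sum_singletons[OF R] by fastforce
  define f where "f a y = (if (\<Sum>a\<in>supp R. D a y) = 1 then D a y else if a = a0 then 1 else 0)" for a y
  have f [measurable]: "f a \<in> borel_measurable Q" for a unfolding f_def by measurable
  have f0: "0 \<le> f a y" for a y using D(3) by (simp add: f_def)
  have densf: "density Q (\<lambda>x. ennreal (f a x)) = \<nu> a" for a
    unfolding densD[symmetric] using one by (intro density_cong) (auto simp: f_def)
  have "(\<integral>z. indicator {a} (snd z) * h (fst z) \<partial>\<gamma>) = (\<integral>y. f a y * h y \<partial>Q)"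
    if [measurable]: "h \<in> borel_measurable borel" for a and h :: "'a \<Rightarrow> real"
  proof -
    have "(\<integral>y. f a y * h y \<partial>Q) = (\<integral>y. h y \<partial>\<nu> a)"
      unfolding densf[symmetric] using f0 by (subst integral_density) auto
    also have "\<dots> = (\<integral>z. h (fst z) \<partial>density \<gamma> (\<lambda>z. ennreal (indicator {a} (snd z))))"
      unfolding \<nu>_def by (subst integral_distr) (auto simp: ennreal_indicator)
    also have "\<dots> = (\<integral>z. indicator {a} (snd z) * h (fst z) \<partial>\<gamma>)"
      by (subst integral_density) auto
    finally show ?thesis ..
  qed
  moreover have "(\<Sum>a\<in>supp R. f a y) = 1" for y
    using fin a0 by (cases "(\<Sum>a\<in>supp R. D a y) = 1") (simp_all add: f_def)
  moreover have "f a \<in> borel_measurable borel" for a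
    using f measurable_cong_sets[OF setsQ refl] by blast
  ultimately show ?thesis using f0 by (intro exI[of _ f]) auto
qed

lemma P2_integrable_norm_diff:
  assumes "Q \<in> P2"
  shows "integrable Q (\<lambda>y. (norm (y - a))\<^sup>2)"
proof (rule Bochner_Integration.integrable_bound)
  interpret prob_space Q using assms by (simp add: P2_def prob_measures_def)
  have [measurable_cong]: "sets Q = sets borel" using assms by (simp add: P2_def prob_measures_def)
  show "integrable Q (\<lambda>y. 2 * (norm y)\<^sup>2 + 2 * (norm a)\<^sup>2)" using assms by (simp add: P2_def)
  show "(\<lambda>y. (norm (y - a))\<^sup>2) \<in> borel_measurable Q" by measurable
  have "(norm (y - a))\<^sup>2 \<le> 2 * (norm y)\<^sup>2 + 2 * (norm a)\<^sup>2" for y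
  proof -
    have "(norm (y - a))\<^sup>2 \<le> (norm y + norm a)\<^sup>2"
      by (intro power_mono norm_triangle_ineq4) simp
    also have "\<dots> \<le> 2 * (norm y)\<^sup>2 + 2 * (norm a)\<^sup>2"
      using sum_squares_bound[of "norm y" "norm a"] by (simp add: power2_sum)
    finally show ?thesis .
  qed
  then show "AE y in Q. norm ((norm (y - a))\<^sup>2) \<le> norm (2 * (norm y)\<^sup>2 + 2 * (norm a)\<^sup>2)"
    by auto
qed

text \<open>Splits the cost according to the atom at which the second coordinate sits; this puts it in
  the form to which the disintegration applies.\<close>
lemma coupling_cost_eq_sum:
  fixes Q R :: "'a::euclidean_space measure"
  assumes R: "discrete_measure R" and \<gamma>: "\<gamma> \<in> couplings2 Q R" and Q: "Q \<in> P2"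
  shows "(\<integral>z. (norm (fst z - snd z))\<^sup>2 \<partial>\<gamma>)
       = (\<Sum>a\<in>supp R. \<integral>z. indicator {a} (snd z) * (norm (fst z - a))\<^sup>2 \<partial>\<gamma>)"
proof -
  interpret \<gamma>: prob_space \<gamma> using \<gamma> by (simp add: couplings2_def)
  have sets\<gamma> [measurable_cong]: "sets \<gamma> = sets (borel \<Otimes>\<^sub>M borel)"
    and fst: "distr \<gamma> borel fst = Q" using \<gamma> by (auto simp: couplings2_def)
  have fin: "finite (supp R)" using R by (simp add: discrete_measure_def)
  have int: "integrable \<gamma> (\<lambda>z. indicator {a} (snd z) * (norm (fst z - a))\<^sup>2)" for a
  proof (rule Bochner_Integration.integrable_bound)
    show "integrable \<gamma> (\<lambda>z. (norm (fst z - a))\<^sup>2)"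
      using P2_integrable_norm_diff[OF Q, of a] unfolding fst[symmetric]
      by (subst (asm) integrable_distr_eq) auto
  qed (auto simp: indicator_def)
  have "(\<integral>z. (norm (fst z - snd z))\<^sup>2 \<partial>\<gamma>)
      = (\<integral>z. (\<Sum>a\<in>supp R. indicator {a} (snd z) * (norm (fst z - a))\<^sup>2) \<partial>\<gamma>)"
  proof (rule integral_cong_AE)
    show "AE z in \<gamma>. (norm (fst z - snd z))\<^sup>2 = (\<Sum>a\<in>supp R. indicator {a} (snd z) * (norm (fst z - a))\<^sup>2)"
      using AE_coupling_snd_in_supp[OF R \<gamma>]
    proof eventually_elim
      case (elim z)
      have "(\<Sum>a\<in>supp R. indicator {a} (snd z) * (norm (fst z - a))\<^sup>2)
          = (\<Sum>a\<in>supp R. if snd z = a then (norm (fst z - a))\<^sup>2 else 0)"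
        by (intro sum.cong) (auto simp: indicator_def)
      then show ?case using elim fin by simp
    qed
  qed measurable
  then show ?thesis using int by (simp add: Bochner_Integration.integral_sum)
qed

section \<open>Averages and products of probability vectors\<close>

text \<open>Steiner's parallel axis identity for the average as centre of mass.\<close>
lemma sum_norm_diff_avg:
  fixes x :: "nat \<Rightarrow> 'a::euclidean_space"
  assumes "N \<ge> 1"
  shows "(\<Sum>i\<in>{1..N}. (norm (y - x i))\<^sup>2)
       = N * (norm (y - avg N x))\<^sup>2 + (\<Sum>i\<in>{1..N}. (norm (x i))\<^sup>2) - N * (norm (avg N x))\<^sup>2"
proof -
  have s: "(\<Sum>i\<in>{1..N}. x i) = real N *\<^sub>R avg N x" using assms by (simp add: avg_def)
  have "(\<Sum>i\<in>{1..N}. (norm (y - x i))\<^sup>2)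
      = (\<Sum>i\<in>{1..N}. (norm y)\<^sup>2 + (norm (x i))\<^sup>2 - 2 * (y \<bullet> x i))"
    by (intro sum.cong) (auto simp: power2_norm_eq_inner inner_diff inner_commute)
  also have "\<dots> = N * (norm y)\<^sup>2 + (\<Sum>i\<in>{1..N}. (norm (x i))\<^sup>2) - 2 * (y \<bullet> (\<Sum>i\<in>{1..N}. x i))"
    by (simp add: sum.distrib sum_subtractf sum_distrib_left[symmetric] inner_sum_right)
  also have "\<dots> = N * (norm (y - avg N x))\<^sup>2 + (\<Sum>i\<in>{1..N}. (norm (x i))\<^sup>2) - N * (norm (avg N x))\<^sup>2"
    unfolding s by (simp add: power2_norm_eq_inner inner_diff inner_commute algebra_simps)
  finally show ?thesis .
qed

text \<open>
  Independent coordinates have the prescribed marginals: after fixing coordinate \<open>i\<close>, the sum of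
  the products factorises and every other factor is 1.
\<close>
lemma sum_prod_marginal:
  fixes f :: "'i \<Rightarrow> 'b \<Rightarrow> real"
  assumes "finite I" "\<And>j. j \<in> I \<Longrightarrow> finite (B j)" "\<And>j. j \<in> I \<Longrightarrow> (\<Sum>b\<in>B j. f j b) = 1"
    and "i \<in> I" "a \<in> B i"
  shows "(\<Sum>x\<in>{x\<in>PiE I B. x i = a}. \<Prod>j\<in>I. f j (x j)) = f i a"
proof -
  let ?B = "B(i := {a})"
  have "{x\<in>PiE I B. x i = a} = PiE I ?B"
    using assms(4,5) by (auto simp: PiE_iff extensional_def split: if_splits)
  then have "(\<Sum>x\<in>{x\<in>PiE I B. x i = a}. \<Prod>j\<in>I. f j (x j)) = (\<Prod>j\<in>I. \<Sum>b\<in>?B j. f j b)"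
    using assms(1,2) by (simp only:) (rule prod_sum_PiE[symmetric], auto)
  also have "\<dots> = (\<Sum>b\<in>?B i. f i b) * (\<Prod>j\<in>I - {i}. \<Sum>b\<in>?B j. f j b)"
    using assms by (intro prod.remove) auto
  also have "(\<Prod>j\<in>I - {i}. \<Sum>b\<in>?B j. f j b) = 1"
    using assms by (intro prod.neutral) auto
  finally show ?thesis by simp
qed

section \<open>Joint weights of discrete marginals\<close>

locale discrete_marginals =
  fixes N :: nat and P :: "nat \<Rightarrow> 'a::euclidean_space measure"
  assumes N: "N \<ge> 1" and P: "i \<in> {1..N} \<Longrightarrow> discrete_measure (P i)"
begin

definition support_tuples :: "(nat \<Rightarrow> 'a) set" where
  "support_tuples = PiE {1..N} (\<lambda>i. supp (P i))"

text \<open>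
  The joint laws with marginals \<open>P\<^sub>i\<close>, as weights on tuples. They are extended by 0 to all functions,
  so that they form a subset of a product space, where compactness can be expressed.
\<close>
definition coupling_weights :: "((nat \<Rightarrow> 'a) \<Rightarrow> real) set" where
  "coupling_weights =
     {w. (\<forall>x. 0 \<le> w x) \<and> (\<forall>x. x \<notin> support_tuples \<longrightarrow> w x = 0) \<and>
         (\<forall>i\<in>{1..N}. \<forall>a\<in>supp (P i).
            (\<Sum>x\<in>{x\<in>support_tuples. x i = a}. w x) = measure (P i) {a})}"

definition weighted_moment :: "((nat \<Rightarrow> 'a) \<Rightarrow> real) \<Rightarrow> real" where
  "weighted_moment w = (\<Sum>x\<in>support_tuples. w x * (norm (avg N x))\<^sup>2)"

lemma finite_support_tuples: "finite support_tuples"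
  using P by (auto simp: support_tuples_def discrete_measure_def intro!: finite_PiE)

lemma support_tuples_memD: "x \<in> support_tuples \<Longrightarrow> i \<in> {1..N} \<Longrightarrow> x i \<in> supp (P i)"
  unfolding support_tuples_def by (rule PiE_mem)

lemma sum_support_tuples_by_coordinate:
  assumes "i \<in> {1..N}"
  shows "(\<Sum>x\<in>support_tuples. w x * h (x i) :: real)
       = (\<Sum>a\<in>supp (P i). (\<Sum>x\<in>{x\<in>support_tuples. x i = a}. w x) * h a)"
proof -
  have "(\<Sum>x\<in>support_tuples. w x * h (x i))
      = (\<Sum>a\<in>supp (P i). \<Sum>x\<in>{x\<in>support_tuples. x i = a}. w x * h (x i))"
    using assms finite_support_tuples P[OF assms]
    by (intro sum.group[symmetric]) (auto simp: discrete_measure_def dest: support_tuples_memD)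
  then show ?thesis by (simp add: sum_distrib_right)
qed

text \<open>A function of a single coordinate has an expectation that depends only on that marginal.\<close>
lemma coupling_weights_coordinate:
  assumes "i \<in> {1..N}" "w \<in> coupling_weights"
  shows "(\<Sum>x\<in>support_tuples. w x * h (x i)) = (\<Sum>a\<in>supp (P i). measure (P i) {a} * h a)"
  using assms by (subst sum_support_tuples_by_coordinate[OF assms(1)])
    (auto simp: coupling_weights_def intro!: sum.cong)

lemma sum_coupling_weights:
  assumes "w \<in> coupling_weights"
  shows "(\<Sum>x\<in>support_tuples. w x) = 1"
proof -
  have 1: "1 \<in> {1..N}" using N by simp
  have "(\<Sum>x\<in>support_tuples. w x * 1) = (\<Sum>a\<in>supp (P 1). measure (P 1) {a} * 1)"
    by (rule coupling_weights_coordinate[OF 1 assms, where h = "\<lambda>_. 1"])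
  then show ?thesis using discrete_measure_sum_singletons[OF P[OF 1]] by simp
qed

definition joint_weight ::
    "'w measure \<Rightarrow> (nat \<Rightarrow> 'w \<Rightarrow> 'a) \<Rightarrow> (nat \<Rightarrow> 'a) \<Rightarrow> real" where
  "joint_weight M X x =
     (if x \<in> support_tuples then measure M {\<omega> \<in> space M. \<forall>i\<in>{1..N}. X i \<omega> = x i} else 0)"

lemma AE_coupled_vector_in_support_tuples:
  assumes "coupled_vector N P M X"
  shows "AE \<omega> in M. (\<lambda>i\<in>{1..N}. X i \<omega>) \<in> support_tuples"
proof -
  have "AE \<omega> in M. X i \<omega> \<in> supp (P i)" if i: "i \<in> {1..N}" for i
  proof -
    have X: "X i \<in> borel_measurable M" and distr: "distr M borel (X i) = P i"
      using assms i by (auto simp: coupled_vector_def)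
    have fin: "finite (supp (P i))" and "P i \<in> prob_measures"
      using P[OF i] by (auto simp: discrete_measure_def)
    then have "AE x in distr M borel (X i). x \<in> supp (P i)"
      using AE_in_supp distr by metis
    then show ?thesis
      by (subst (asm) AE_distr_iff[OF X]) (auto intro: borel_closed finite_imp_closed fin)
  qed
  then have "AE \<omega> in M. \<forall>i\<in>{1..N}. X i \<omega> \<in> supp (P i)" by (subst AE_finite_all) auto
  then show ?thesis
    by eventually_elim (auto simp: support_tuples_def)
qed

text \<open>
  Almost surely the vector takes one of finitely many values, so \<open>u\<close> of it agrees with a finite sum
  over the events on which it equals a given tuple. Only the composition is required to be
  measurable, since \<open>u\<close> is defined on a function space without a chosen \<open>\<sigma>\<close>-algebra.
\<close>
lemma expectation_joint_weight:
  fixes u :: "(nat \<Rightarrow> 'a) \<Rightarrow> real"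
  assumes vec: "coupled_vector N P M X"
    and meas: "(\<lambda>\<omega>. u (\<lambda>i\<in>{1..N}. X i \<omega>)) \<in> borel_measurable M"
  shows "integrable M (\<lambda>\<omega>. u (\<lambda>i\<in>{1..N}. X i \<omega>))" (is ?I)
    and "(\<integral>\<omega>. u (\<lambda>i\<in>{1..N}. X i \<omega>) \<partial>M) = (\<Sum>x\<in>support_tuples. joint_weight M X x * u x)" (is ?E)
proof -
  interpret prob_space M using vec by (simp add: coupled_vector_def)
  have X [measurable]: "X i \<in> borel_measurable M" if "i \<in> {1..N}" for i
    using vec that by (auto simp: coupled_vector_def)
  let ?T = support_tuples
  define E where "E x = {\<omega> \<in> space M. \<forall>i\<in>{1..N}. X i \<omega> = x i}" for x
  have finT: "finite ?T" by (rule finite_support_tuples)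
  have E [measurable]: "E x \<in> sets M" for x
    unfolding E_def by (intro sets.sets_Collect_finite_All' borel_measurable_eq X) (use N in auto)
  have jw: "joint_weight M X x = prob (E x)" if "x \<in> ?T" for x
    using that by (simp add: joint_weight_def E_def)
  have iff: "(\<lambda>i\<in>{1..N}. X i \<omega>) = x \<longleftrightarrow> \<omega> \<in> E x" if "\<omega> \<in> space M" "x \<in> ?T" for \<omega> x
    using that unfolding E_def support_tuples_def
    by (auto simp: fun_eq_iff restrict_def PiE_iff extensional_def)
  have eq: "AE \<omega> in M. (\<Sum>x\<in>?T. indicator (E x) \<omega> * u x) = u (\<lambda>i\<in>{1..N}. X i \<omega>)"
    using AE_coupled_vector_in_support_tuples[OF vec] AE_space
  proof eventually_elim
    case (elim \<omega>)
    have "(\<Sum>x\<in>?T. indicator (E x) \<omega> * u x)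
        = (\<Sum>x\<in>?T. if (\<lambda>i\<in>{1..N}. X i \<omega>) = x then u x else 0)"
      using iff[OF elim(2)] by (intro sum.cong) (auto simp: indicator_def)
    then show ?case using elim finT by simp
  qed
  have int: "integrable M (\<lambda>\<omega>. \<Sum>x\<in>?T. indicator (E x) \<omega> * u x)"
    by (intro Bochner_Integration.integrable_sum integrable_mult_left integrable_real_indicator)
      (auto simp: emeasure_eq_measure)
  have "(\<integral>\<omega>. (\<Sum>x\<in>?T. indicator (E x) \<omega> * u x) \<partial>M) = (\<Sum>x\<in>?T. joint_weight M X x * u x)"
    by (subst Bochner_Integration.integral_sum)
      (auto simp: jw emeasure_eq_measure intro!: sum.cong)
  then show ?I ?E
    using integrable_cong_AE_imp[OF int meas] integral_cong_AE[OF _ meas eq] int eq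
    by (auto simp: AE_symmetric)
qed

lemma joint_weight_in_coupling_weights:
  assumes vec: "coupled_vector N P M X"
  shows "joint_weight M X \<in> coupling_weights"
  unfolding coupling_weights_def
proof (intro CollectI conjI allI ballI impI)
  fix i a assume i: "i \<in> {1..N}" and a: "a \<in> supp (P i)"
  have X [measurable]: "X i \<in> borel_measurable M" and distr: "distr M borel (X i) = P i"
    using vec i by (auto simp: coupled_vector_def)
  have m: "(\<lambda>\<omega>. indicator {a} (X i \<omega>) :: real) \<in> borel_measurable M" by measurable
  have "(\<Sum>x\<in>{x\<in>support_tuples. x i = a}. joint_weight M X x)
      = (\<Sum>x\<in>support_tuples. joint_weight M X x * indicator {a} (x i))"
    using finite_support_tuples by (intro sum.mono_neutral_cong_left) (auto simp: indicator_def)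
  also have "\<dots> = (\<integral>\<omega>. indicator {a} (X i \<omega>) \<partial>M)"
    using expectation_joint_weight(2)[OF vec, of "\<lambda>x. indicator {a} (x i)"] m i by simp
  also have "\<dots> = (\<integral>x. indicator {a} x \<partial>distr M borel (X i))"
    by (subst integral_distr) auto
  also have "\<dots> = measure (P i) {a}"
    unfolding distr using P[OF i]
    by (auto simp: discrete_measure_def prob_measures_def dest: sets_eq_imp_space_eq)
  finally show "(\<Sum>x\<in>{x\<in>support_tuples. x i = a}. joint_weight M X x) = measure (P i) {a}" .
qed (auto simp: joint_weight_def)

text \<open>
  Conversely, every weight is realised by the coordinate functions on the finite space of tuples.
\<close>
lemma coupled_vector_of_weights:
  assumes w: "w \<in> coupling_weights"
  defines "M \<equiv> point_measure support_tuples w"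
  shows "coupled_vector N P M (\<lambda>i x. x i)" "mean_moment N M (\<lambda>i x. x i) = weighted_moment w"
proof -
  let ?T = "support_tuples"
  have finT: "finite ?T" by (rule finite_support_tuples)
  have w0: "0 \<le> w x" for x using w by (simp add: coupling_weights_def)
  have meas: "measure M A = (\<Sum>x\<in>A. w x)" if "A \<subseteq> ?T" for A
    using that finT w0 unfolding M_def
    by (simp add: measure_def emeasure_point_measure_finite sum_nonneg finite_subset)
  interpret prob_space M
    unfolding M_def using finT w0 sum_coupling_weights[OF w] by (intro prob_spaceI)
      (simp add: space_point_measure emeasure_point_measure_finite sum_ennreal)
  have X [measurable]: "(\<lambda>x. x i) \<in> borel_measurable M" for i by (simp add: M_def)
  have "distr M borel (\<lambda>x. x i) = P i" if i: "i \<in> {1..N}" for i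
  proof (rule measure_eqI)
    have Pi: "sets (P i) = sets borel" "prob_space (P i)"
      using P[OF i] by (auto simp: discrete_measure_def prob_measures_def)
    interpret Pi: prob_space "P i" by fact
    show "sets (distr M borel (\<lambda>x. x i)) = sets (P i)" using Pi by simp
    fix A assume "A \<in> sets (distr M borel (\<lambda>x. x i))"
    then have A: "A \<in> sets borel" by simp
    have "(\<lambda>x. x i) -` A \<inter> space M = {x\<in>?T. x i \<in> A}"
      by (auto simp: M_def space_point_measure)
    then have "measure M ((\<lambda>x. x i) -` A \<inter> space M) = (\<Sum>x\<in>{x\<in>?T. x i \<in> A}. w x)"
      by (simp add: meas)
    also have "\<dots> = (\<Sum>x\<in>?T. w x * indicator A (x i))"
      using finT by (intro sum.mono_neutral_cong_left) (auto simp: indicator_def)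
    also have "\<dots> = (\<Sum>a\<in>supp (P i). measure (P i) {a} * indicator A a)"
      by (rule coupling_weights_coordinate[OF i w])
    also have "\<dots> = (\<Sum>a\<in>supp (P i) \<inter> A. measure (P i) {a})"
      using P[OF i] by (intro sum.mono_neutral_cong_right)
        (auto simp: indicator_def discrete_measure_def)
    also have "\<dots> = measure (P i) A" using discrete_measure_eq_sum_singleton[OF P[OF i] A] by simp
    finally show "emeasure (distr M borel (\<lambda>x. x i)) A = emeasure (P i) A"
      using A by (simp add: emeasure_distr emeasure_eq_measure Pi.emeasure_eq_measure)
  qed
  then show "coupled_vector N P M (\<lambda>i x. x i)"
    using prob_space_axioms by (simp add: coupled_vector_def)
  show "mean_moment N M (\<lambda>i x. x i) = weighted_moment w"
    unfolding mean_moment_def weighted_moment_def M_def mean_vector_def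
    using finT w0 by (subst lebesgue_integral_point_measure_finite) auto
qed

section \<open>Attainment of the supremum\<close>

text \<open>
  Weights are at most 1 and vanish off the tuples, so they lie in a product of compact sets, which is
  compact by Tychonoff's theorem. The marginal constraints involve finitely many coordinates each and
  therefore define a closed set.
\<close>
lemma compact_coupling_weights:
  shows "compact (coupling_weights)"
proof -
  let ?T = "support_tuples"
  let ?B = "PiE UNIV (\<lambda>x. if x \<in> ?T then {0..1} else {0 :: real})"
  let ?L = "{w :: (nat \<Rightarrow> 'a) \<Rightarrow> real. \<forall>i\<in>{1..N}. \<forall>a\<in>supp (P i).
              (\<Sum>x\<in>{x\<in>?T. x i = a}. w x) = measure (P i) {a}}"
  have finT: "finite ?T" by (rule finite_support_tuples)
  have "compact ?B"
    using compactin_PiE[of "\<lambda>_. euclidean" UNIV "\<lambda>x. if x \<in> ?T then {0..1} else {0 :: real}"]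
    by (simp add: euclidean_product_topology)
  moreover have "closed ?L"
  proof -
    have "?L = (\<Inter>i\<in>{1..N}. \<Inter>a\<in>supp (P i).
        {w. (\<Sum>x\<in>{x\<in>?T. x i = a}. w x) = measure (P i) {a}})" by auto
    also have "closed \<dots>"
      by (intro closed_INT ballI closed_Collect_eq continuous_on_sum continuous_on_product_coordinates
          continuous_on_const)
    finally show ?thesis .
  qed
  moreover have "coupling_weights = ?B \<inter> ?L"
  proof -
    have "w x \<le> 1" if w: "w \<in> coupling_weights" and x: "x \<in> ?T" for w x
      using member_le_sum[of x ?T w] sum_coupling_weights[OF w] w x finT
      by (auto simp: coupling_weights_def)
    then show ?thesis
      by (intro equalityI subsetI IntI PiE_I) (auto simp: coupling_weights_def PiE_iff split: if_splits)
  qed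
  ultimately show ?thesis by (simp add: compact_Int_closed)
qed

text \<open>The independent coupling gives an element.\<close>
lemma coupling_weights_nonempty: "coupling_weights \<noteq> {}"
proof -
  let ?w = "\<lambda>x. if x \<in> support_tuples then \<Prod>j\<in>{1..N}. measure (P j) {x j} else 0"
  have "(\<Sum>x\<in>{x\<in>support_tuples. x i = a}. ?w x) = measure (P i) {a}"
    if "i \<in> {1..N}" "a \<in> supp (P i)" for i a
    using sum_prod_marginal[of "{1..N}" "\<lambda>i. supp (P i)" "\<lambda>i a. measure (P i) {a}" i a] that P
    by (simp add: support_tuples_def discrete_measure_def discrete_measure_sum_singletons)
  then have "?w \<in> coupling_weights"
    by (auto simp: coupling_weights_def intro!: prod_nonneg)
  then show ?thesis by blast
qed

lemma mean_moment_eq_weighted_moment: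
  assumes X: "coupled_vector N P M X"
  shows "mean_moment N M X = weighted_moment (joint_weight M X)"
proof -
  let ?w = "joint_weight M X"
  have [measurable]: "X i \<in> borel_measurable M" if "i \<in> {1..N}" for i
    using X that by (auto simp: coupled_vector_def)
  have mean: "(norm (avg N (\<lambda>i\<in>{1..N}. X i \<omega>)))\<^sup>2 = (norm (mean_vector N X \<omega>))\<^sup>2" for \<omega>
    by (simp add: avg_def mean_vector_def)
  have "mean_vector N X \<in> borel_measurable M"
    unfolding mean_vector_def avg_def by measurable
  then have "(\<integral>\<omega>. (norm (mean_vector N X \<omega>))\<^sup>2 \<partial>M) = (\<Sum>x\<in>support_tuples. ?w x * (norm (avg N x))\<^sup>2)"
    using expectation_joint_weight(2)[OF X, of "\<lambda>x. (norm (avg N x))\<^sup>2"] unfolding mean by auto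
  then show ?thesis by (auto simp: mean_moment_def weighted_moment_def)
qed

text \<open>
  Passing between vectors and weights in both directions, the supremum is that of a continuous
  function on a nonempty compact set.
\<close>
lemma
  shows sup_mean_moment_attained: "\<exists>(M :: (nat \<Rightarrow> 'a) measure) X. coupled_vector N P M X \<and> mean_moment N M X = sup_mean_moment N P"
    and weighted_moment_le_sup: "\<And>w. w \<in> coupling_weights \<Longrightarrow> weighted_moment w \<le> sup_mean_moment N P"
proof -
  let ?S = "{mean_moment N M X | (M :: (nat \<Rightarrow> 'a) measure) X. coupled_vector N P M X}"
  have S: "?S = weighted_moment ` coupling_weights"
  proof
    show "?S \<subseteq> weighted_moment ` coupling_weights"
      using mean_moment_eq_weighted_moment joint_weight_in_coupling_weights by blast
    show "weighted_moment ` coupling_weights \<subseteq> ?S"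
    proof
      fix m assume "m \<in> weighted_moment ` coupling_weights"
      then obtain w where "w \<in> coupling_weights" "m = weighted_moment w" by blast
      then have "coupled_vector N P (point_measure support_tuples w) (\<lambda>i x. x i)"
        "m = mean_moment N (point_measure support_tuples w) (\<lambda>i x. x i)"
        using coupled_vector_of_weights by simp_all
      then show "m \<in> ?S" by blast
    qed
  qed
  have "continuous_on coupling_weights weighted_moment"
    unfolding weighted_moment_def
    by (intro continuous_on_sum continuous_on_mult continuous_on_const
        continuous_on_subset[OF continuous_on_product_coordinates]) auto
  then obtain w0 where w0: "w0 \<in> coupling_weights"
    "\<And>w. w \<in> coupling_weights \<Longrightarrow> weighted_moment w \<le> weighted_moment w0"
    using continuous_attains_sup compact_coupling_weights coupling_weights_nonempty
    by metis
  have "sup_mean_moment N P = weighted_moment w0"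
    unfolding sup_mean_moment_def S using w0 by (intro cSup_eq_maximum) auto
  then show "\<exists>(M :: (nat \<Rightarrow> 'a) measure) X. coupled_vector N P M X \<and> mean_moment N M X = sup_mean_moment N P"
    and "\<And>w. w \<in> coupling_weights \<Longrightarrow> weighted_moment w \<le> sup_mean_moment N P"
    using coupled_vector_of_weights[OF w0(1)] w0(2) by auto
qed

section \<open>The cost of the law of an average\<close>

definition total_second_moment :: real where
  "total_second_moment = (\<Sum>i\<in>{1..N}. \<Sum>a\<in>supp (P i). measure (P i) {a} * (norm a)\<^sup>2)"

text \<open>The expectation of the sum of the squared norms is the same for all joint laws; this turns
  minimising the total cost into maximising the moment of the average.\<close>
lemma total_second_moment_eq:
  assumes "w \<in> coupling_weights"
  shows "(\<Sum>x\<in>support_tuples. w x * (\<Sum>i\<in>{1..N}. (norm (x i))\<^sup>2)) = total_second_moment"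
  unfolding total_second_moment_def sum_distrib_left
  by (subst sum.swap) (intro sum.cong refl coupling_weights_coordinate assms; simp)

lemma
  shows finite_averages: "finite (averages N P)"
    and avg_in_averages: "\<And>x. x \<in> support_tuples \<Longrightarrow> avg N x \<in> averages N P"
proof -
  have "averages N P \<subseteq> avg N ` support_tuples"
  proof
    fix y assume "y \<in> averages N P"
    then obtain x where x: "y = avg N x" "\<forall>i\<in>{1..N}. x i \<in> supp (P i)" by (auto simp: averages_def)
    then have "y = avg N (restrict x {1..N})" "restrict x {1..N} \<in> support_tuples"
      by (auto simp: avg_def support_tuples_def)
    then show "y \<in> avg N ` support_tuples" by blast
  qed
  then show "finite (averages N P)"
    using finite_support_tuples finite_surj by metis
  show "avg N x \<in> averages N P" if "x \<in> support_tuples" for x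
    using that by (auto simp: averages_def simp del: One_nat_def intro!: exI[of _ x] support_tuples_memD)
qed

text \<open>
  The pair of the average and \<open>X\<^sub>i\<close> couples the law of the average with \<open>P\<^sub>i\<close>. The costs of these
  couplings are summed by the parallel axis identity with \<open>y\<close> the average itself, for which the
  first term vanishes.
\<close>
lemma
  assumes X: "coupled_vector N P M X"
  shows mean_law_in_P2: "mean_law N M X \<in> P2"
    and supp_mean_law_subset: "supp (mean_law N M X) \<subseteq> averages N P"
    and sum_W2_mean_law_le: "(\<Sum>i\<in>{1..N}. (W2 (mean_law N M X) (P i))\<^sup>2)
           \<le> total_second_moment - N * mean_moment N M X"
proof -
  interpret prob_space M using X by (simp add: coupled_vector_def)
  let ?T = "support_tuples" and ?Y = "mean_vector N X"
  let ?w = "joint_weight M X"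
  have w: "?w \<in> coupling_weights" using X by (rule joint_weight_in_coupling_weights)
  have Xm [measurable]: "X i \<in> borel_measurable M" and distr: "distr M borel (X i) = P i"
    if "i \<in> {1..N}" for i
    using X that by (auto simp: coupled_vector_def)
  have mean: "avg N (\<lambda>i\<in>{1..N}. X i \<omega>) = ?Y \<omega>" for \<omega>
    by (simp add: avg_def mean_vector_def)
  have Y [measurable]: "?Y \<in> borel_measurable M"
    unfolding mean_vector_def avg_def by measurable
  have moment: "integrable M (\<lambda>\<omega>. (norm (?Y \<omega>))\<^sup>2)"
    using expectation_joint_weight(1)[OF X, of "\<lambda>x. (norm (avg N x))\<^sup>2"] unfolding mean by auto
  have L: "mean_law N M X \<in> prob_measures"
    by (simp add: prob_measures_def mean_law_def prob_space_distr)
  then show "mean_law N M X \<in> P2"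
    using moment by (simp add: P2_def mean_law_def integrable_distr_eq)
  have closed: "closed (averages N P)" using finite_averages by (rule finite_imp_closed)
  have "AE \<omega> in M. ?Y \<omega> \<in> averages N P"
    using AE_coupled_vector_in_support_tuples[OF X] by eventually_elim (use avg_in_averages mean in metis)
  then have "AE y in mean_law N M X. y \<in> averages N P"
    unfolding mean_law_def using closed by (subst AE_distr_iff) (auto intro: borel_closed)
  then show "supp (mean_law N M X) \<subseteq> averages N P"
    by (intro supp_subset_closed L closed)
  have le: "(W2 (mean_law N M X) (P i))\<^sup>2 \<le> (\<Sum>x\<in>?T. ?w x * (norm (avg N x - x i))\<^sup>2)"
    if i: "i \<in> {1..N}" for i
  proof -
    let ?\<gamma> = "distr M (borel \<Otimes>\<^sub>M borel) (\<lambda>\<omega>. (?Y \<omega>, X i \<omega>))"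
    have pair [measurable]: "(\<lambda>\<omega>. (?Y \<omega>, X i \<omega>)) \<in> measurable M (borel \<Otimes>\<^sub>M borel)"
      using Xm[OF i] by measurable
    have "?\<gamma> \<in> couplings2 (mean_law N M X) (P i)"
      using distr[OF i]
      by (simp add: couplings2_def prob_space_distr distr_distr comp_def mean_law_def)
    then have "(W2 (mean_law N M X) (P i))\<^sup>2 \<le> (\<integral>z. (norm (fst z - snd z))\<^sup>2 \<partial>?\<gamma>)"
      using L P[OF i] by (intro W2_squared_le) (auto simp: discrete_measure_def)
    also have "\<dots> = (\<integral>\<omega>. (norm (?Y \<omega> - X i \<omega>))\<^sup>2 \<partial>M)"
      by (subst integral_distr) auto
    also have "\<dots> = (\<Sum>x\<in>?T. ?w x * (norm (avg N x - x i))\<^sup>2)"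
      using expectation_joint_weight(2)[OF X, of "\<lambda>x. (norm (avg N x - x i))\<^sup>2"] Xm[OF i] i unfolding mean by auto
    finally show ?thesis .
  qed
  have "(\<Sum>i\<in>{1..N}. (W2 (mean_law N M X) (P i))\<^sup>2)
      \<le> (\<Sum>i\<in>{1..N}. \<Sum>x\<in>?T. ?w x * (norm (avg N x - x i))\<^sup>2)"
    by (intro sum_mono le)
  also have "\<dots> = (\<Sum>x\<in>?T. ?w x * (\<Sum>i\<in>{1..N}. (norm (avg N x - x i))\<^sup>2))"
    unfolding sum_distrib_left by (rule sum.swap)
  also have "\<dots> = (\<Sum>x\<in>?T. ?w x * (\<Sum>i\<in>{1..N}. (norm (x i))\<^sup>2)) - N * weighted_moment ?w"
    unfolding sum_norm_diff_avg[OF N] weighted_moment_def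
    by (simp add: right_diff_distrib sum_subtractf sum_distrib_left mult.left_commute)
  finally show "(\<Sum>i\<in>{1..N}. (W2 (mean_law N M X) (P i))\<^sup>2)
           \<le> total_second_moment - N * mean_moment N M X"
    unfolding mean_moment_eq_weighted_moment[OF X] total_second_moment_eq[OF w] .
qed

section \<open>The lower bound for arbitrary measures\<close>

lemma averages_nonempty: "averages N P \<noteq> {}"
  using coupling_weights_nonempty sum_coupling_weights avg_in_averages
  by (metis ex_in_conv sum.empty zero_neq_one)

lemma integrable_infdist_averages:
  assumes Q: "Q \<in> P2"
  shows "integrable Q (\<lambda>y. (infdist y (averages N P))\<^sup>2)"
proof -
  obtain s where s: "s \<in> averages N P" using averages_nonempty by blast
  have [measurable_cong]: "sets Q = sets borel" using Q by (simp add: P2_def prob_measures_def)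
  show ?thesis
  proof (rule Bochner_Integration.integrable_bound)
    show "integrable Q (\<lambda>y. (norm (y - s))\<^sup>2)" using Q by (rule P2_integrable_norm_diff)
    show "AE y in Q. norm ((infdist y (averages N P))\<^sup>2) \<le> norm ((norm (y - s))\<^sup>2)"
      using infdist_le[OF s] by (intro AE_I2) (simp add: dist_norm power_mono infdist_nonneg)
    have "(\<lambda>y. (infdist y (averages N P))\<^sup>2) \<in> borel_measurable borel"
      by (intro borel_measurable_continuous_onI continuous_intros)
    then show "(\<lambda>y. (infdist y (averages N P))\<^sup>2) \<in> borel_measurable Q" by measurable
  qed
qed

text \<open>
  Gluing along \<open>Q\<close> with the coordinates conditionally independent: \<open>g x y\<close> is the conditional
  probability of the tuple \<open>x\<close> given \<open>y\<close>. The costs only see the pair marginals, so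
  they can be computed from \<open>g\<close>, where for each \<open>y\<close> the parallel axis identity applies under the
  sum over \<open>x\<close>. The term \<open>|y - xbar|\<^sup>2\<close> is at least the squared distance from \<open>y\<close> to the set
  of averages, and the remaining terms involve only the joint law \<open>w\<close> of the coordinates.
\<close>
lemma coupling_costs_lower_bound:
  assumes Q: "Q \<in> P2" and \<gamma>: "\<And>i. i \<in> {1..N} \<Longrightarrow> \<gamma> i \<in> couplings2 Q (P i)"
  shows "N * (\<integral>y. (infdist y (averages N P))\<^sup>2 \<partial>Q) + total_second_moment - N * sup_mean_moment N P
       \<le> (\<Sum>i\<in>{1..N}. \<integral>z. (norm (fst z - snd z))\<^sup>2 \<partial>\<gamma> i)"
proof -
  let ?T = support_tuples and ?S = "averages N P"
  have Qp: "Q \<in> prob_measures" using Q by (simp add: P2_def)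
  interpret Q: prob_space Q using Qp by (simp add: prob_measures_def)
  have setsQ [measurable_cong]: "sets Q = sets borel" using Qp by (simp add: prob_measures_def)
  have fin: "finite (supp (P i))" if "i \<in> {1..N}" for i
    using P[OF that] by (simp add: discrete_measure_def)
  have "\<forall>i\<in>{1..N}. \<exists>f :: 'a \<Rightarrow> 'a \<Rightarrow> real.
    (\<forall>a. f a \<in> borel_measurable borel) \<and> (\<forall>a y. 0 \<le> f a y) \<and> (\<forall>y. (\<Sum>a\<in>supp (P i). f a y) = 1) \<and>
    (\<forall>a\<in>supp (P i). \<forall>h :: 'a \<Rightarrow> real. h \<in> borel_measurable borel \<longrightarrow>
       (\<integral>z. indicator {a} (snd z) * h (fst z) \<partial>\<gamma> i) = (\<integral>y. f a y * h y \<partial>Q))"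
    using discrete_disintegration[OF Qp P \<gamma>] by blast
  then obtain f where f: "\<forall>i\<in>{1..N}.
    (\<forall>a. f i a \<in> borel_measurable borel) \<and> (\<forall>a y. 0 \<le> f i a y) \<and> (\<forall>y. (\<Sum>a\<in>supp (P i). f i a y) = 1) \<and>
    (\<forall>a\<in>supp (P i). \<forall>h :: 'a \<Rightarrow> real. h \<in> borel_measurable borel \<longrightarrow>
       (\<integral>z. indicator {a} (snd z) * h (fst z) \<partial>\<gamma> i) = (\<integral>y. f i a y * h y \<partial>Q))"
    by (subst (asm) bchoice_iff) blast
  have fm [measurable]: "f i a \<in> borel_measurable borel" and f0: "0 \<le> f i a y"
    and f1: "(\<Sum>a\<in>supp (P i). f i a y) = 1" if "i \<in> {1..N}" for i a y
    using f that by blast+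
  have fh: "(\<integral>z. indicator {a} (snd z) * h (fst z) \<partial>\<gamma> i) = (\<integral>y. f i a y * h y \<partial>Q)"
    if "i \<in> {1..N}" "a \<in> supp (P i)" "h \<in> borel_measurable borel" for i a and h :: "'a \<Rightarrow> real"
    using f that by blast
  have f_le: "f i a y \<le> 1" if "i \<in> {1..N}" "a \<in> supp (P i)" for i a y
    using member_le_sum[of a "supp (P i)" "\<lambda>a. f i a y"] fin f0 f1 that by simp
  define g where "g x y = (\<Prod>j\<in>{1..N}. f j (x j) y)" for x y
  have gm [measurable]: "g x \<in> borel_measurable borel" for x
    unfolding g_def by (intro borel_measurable_prod fm)
  have g0: "0 \<le> g x y" for x y unfolding g_def by (intro prod_nonneg ballI f0)
  have g_le: "g x y \<le> 1" if "x \<in> ?T" for x y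
    unfolding g_def by (intro prod_le_1 conjI f0 f_le support_tuples_memD[OF that])
  have g_int: "integrable Q (g x)" if "x \<in> ?T" for x
    by (rule Q.integrable_const_bound[of _ 1]) (use g0 g_le[OF that] in auto)
  have marginal: "(\<Sum>x\<in>{x\<in>?T. x i = a}. g x y) = f i a y" if "i \<in> {1..N}" "a \<in> supp (P i)" for i a y
    unfolding g_def support_tuples_def
    by (rule sum_prod_marginal[where f = "\<lambda>j b. f j b y"]) (use that fin f1 in auto)
  have g1: "(\<Sum>x\<in>?T. g x y) = 1" for y
    using prod_sum_PiE[of "{1..N}" "\<lambda>i. supp (P i)" "\<lambda>j b. f j b y"] fin f1
    by (simp add: g_def support_tuples_def)
  define w where "w x = (if x \<in> ?T then \<integral>y. g x y \<partial>Q else 0)" for x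
  have w: "w \<in> coupling_weights"
    unfolding coupling_weights_def
  proof (intro CollectI conjI allI ballI impI)
    fix i a assume i: "i \<in> {1..N}" and a: "a \<in> supp (P i)"
    have sets\<gamma> [measurable_cong]: "sets (\<gamma> i) = sets (borel \<Otimes>\<^sub>M borel)"
      and snd: "distr (\<gamma> i) borel snd = P i" using \<gamma>[OF i] by (auto simp: couplings2_def)
    have "(\<Sum>x\<in>{x\<in>?T. x i = a}. w x) = (\<integral>y. (\<Sum>x\<in>{x\<in>?T. x i = a}. g x y) \<partial>Q)"
      by (subst Bochner_Integration.integral_sum) (auto simp: w_def g_int)
    also have "\<dots> = (\<integral>y. f i a y * 1 \<partial>Q)" using marginal[OF i a] by simp
    also have "\<dots> = (\<integral>z. indicator {a} (snd z) * 1 \<partial>\<gamma> i)"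
      using fh[OF i a, of "\<lambda>_. 1"] by simp
    also have "\<dots> = (\<integral>x. indicator {a} x \<partial>distr (\<gamma> i) borel snd)"
      by (subst integral_distr) auto
    also have "\<dots> = measure (P i) {a}"
      unfolding snd using P[OF i]
      by (auto simp: discrete_measure_def prob_measures_def dest: sets_eq_imp_space_eq)
    finally show "(\<Sum>x\<in>{x\<in>?T. x i = a}. w x) = measure (P i) {a}" .
  qed (auto simp: w_def intro!: Bochner_Integration.integral_nonneg g0)
  let ?e = "\<lambda>x. (\<Sum>i\<in>{1..N}. (norm (x i))\<^sup>2) - N * (norm (avg N x))\<^sup>2"
  let ?low = "\<lambda>y. N * (infdist y ?S)\<^sup>2 + (\<Sum>x\<in>?T. g x y * ?e x)"
  let ?up = "\<lambda>y. \<Sum>i\<in>{1..N}. \<Sum>a\<in>supp (P i). f i a y * (norm (y - a))\<^sup>2"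
  have le: "?low y \<le> ?up y" for y
  proof -
    have "?up y = (\<Sum>i\<in>{1..N}. \<Sum>x\<in>?T. g x y * (norm (y - x i))\<^sup>2)"
      using marginal by (intro sum.cong refl)
        (simp add: sum_support_tuples_by_coordinate[where h = "\<lambda>a. (norm (y - a))\<^sup>2" and w = "\<lambda>x. g x y"])
    also have "\<dots> = (\<Sum>x\<in>?T. g x y * (\<Sum>i\<in>{1..N}. (norm (y - x i))\<^sup>2))"
      unfolding sum_distrib_left by (rule sum.swap)
    also have "\<dots> \<ge> (\<Sum>x\<in>?T. g x y * (N * (infdist y ?S)\<^sup>2 + ?e x))"
    proof (intro sum_mono mult_left_mono g0)
      fix x assume "x \<in> ?T"
      then have "infdist y ?S \<le> norm (y - avg N x)"
        using infdist_le[OF avg_in_averages, of x y] by (simp add: dist_norm)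
      then have "N * (infdist y ?S)\<^sup>2 \<le> N * (norm (y - avg N x))\<^sup>2"
        by (intro mult_left_mono power_mono infdist_nonneg) auto
      then show "N * (infdist y ?S)\<^sup>2 + ?e x \<le> (\<Sum>i\<in>{1..N}. (norm (y - x i))\<^sup>2)"
        unfolding sum_norm_diff_avg[OF N] by simp
    qed
    also have "(\<Sum>x\<in>?T. g x y * (N * (infdist y ?S)\<^sup>2 + ?e x)) = ?low y"
      using g1[of y] by (simp only: distrib_left sum.distrib sum_distrib_right[symmetric])
    finally show ?thesis .
  qed
  have inf_int: "integrable Q (\<lambda>y. (infdist y ?S)\<^sup>2)"
    using Q by (rule integrable_infdist_averages)
  have f_int: "integrable Q (\<lambda>y. f i a y * (norm (y - a))\<^sup>2)" if i: "i \<in> {1..N}" "a \<in> supp (P i)" for i a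
  proof (rule Bochner_Integration.integrable_bound)
    show "integrable Q (\<lambda>y. (norm (y - a))\<^sup>2)" using Q by (rule P2_integrable_norm_diff)
    show "(\<lambda>y. f i a y * (norm (y - a))\<^sup>2) \<in> borel_measurable Q" using fm[OF i(1), of a] by measurable
    show "AE y in Q. norm (f i a y * (norm (y - a))\<^sup>2) \<le> norm ((norm (y - a))\<^sup>2)"
      using f0[OF i(1)] f_le[OF i] by (intro AE_I2) (simp add: abs_mult mult_left_le_one_le)
  qed
  have "N * (\<integral>y. (infdist y ?S)\<^sup>2 \<partial>Q) + total_second_moment - N * sup_mean_moment N P
      \<le> N * (\<integral>y. (infdist y ?S)\<^sup>2 \<partial>Q) + total_second_moment - N * weighted_moment w"
    using weighted_moment_le_sup[OF w] by (simp add: mult_left_mono)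
  also have "\<dots> = N * (\<integral>y. (infdist y ?S)\<^sup>2 \<partial>Q) + (\<Sum>x\<in>?T. w x * ?e x)"
    unfolding total_second_moment_eq[OF w, symmetric] weighted_moment_def
    by (simp add: right_diff_distrib sum_subtractf sum_distrib_left mult.left_commute)
  also have "\<dots> = (\<integral>y. ?low y \<partial>Q)"
    using inf_int g_int by (simp add: w_def)
  also have "\<dots> \<le> (\<integral>y. ?up y \<partial>Q)"
    using inf_int g_int f_int le by (intro integral_mono) auto
  also have "\<dots> = (\<Sum>i\<in>{1..N}. \<Sum>a\<in>supp (P i). \<integral>y. f i a y * (norm (y - a))\<^sup>2 \<partial>Q)"
    using f_int by simp
  also have "\<dots> = (\<Sum>i\<in>{1..N}. \<integral>z. (norm (fst z - snd z))\<^sup>2 \<partial>\<gamma> i)"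
  proof (intro sum.cong refl)
    fix i assume i: "i \<in> {1..N}"
    show "(\<Sum>a\<in>supp (P i). \<integral>y. f i a y * (norm (y - a))\<^sup>2 \<partial>Q) = (\<integral>z. (norm (fst z - snd z))\<^sup>2 \<partial>\<gamma> i)"
      unfolding coupling_cost_eq_sum[OF P[OF i] \<gamma>[OF i] Q]
      by (intro sum.cong refl fh[OF i, symmetric]) auto
  qed
  finally show ?thesis .
qed

text \<open>
  Applies the bound to couplings that are optimal up to \<open>e / N\<close> and lets \<open>e\<close> tend to 0.
\<close>
lemma sum_W2_squared_lower_bound:
  assumes Q: "Q \<in> P2"
  shows "N * (\<integral>y. (infdist y (averages N P))\<^sup>2 \<partial>Q) + total_second_moment - N * sup_mean_moment N P
       \<le> (\<Sum>i\<in>{1..N}. (W2 Q (P i))\<^sup>2)"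
proof (rule field_le_epsilon)
  fix e :: real assume e: "0 < e"
  let ?c = "\<lambda>\<gamma>. \<integral>z. (norm (fst z - snd z))\<^sup>2 \<partial>\<gamma>"
  have Qp: "Q \<in> prob_measures" using Q by (simp add: P2_def)
  have "\<exists>\<gamma>\<in>couplings2 Q (P i). ?c \<gamma> < (W2 Q (P i))\<^sup>2 + e / N" if i: "i \<in> {1..N}" for i
  proof -
    have Pi: "P i \<in> prob_measures" using P[OF i] by (simp add: discrete_measure_def)
    have "(INF \<gamma>\<in>couplings2 Q (P i). ?c \<gamma>) < (W2 Q (P i))\<^sup>2 + e / N"
      using e N by (simp add: W2_squared[OF Qp Pi])
    then show ?thesis
      using couplings2_nonempty[OF Qp Pi] by (subst (asm) cINF_less_iff) (auto intro: bdd_belowI2[where m=0])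
  qed
  then obtain \<gamma> where \<gamma>: "\<And>i. i \<in> {1..N} \<Longrightarrow> \<gamma> i \<in> couplings2 Q (P i)"
    "\<And>i. i \<in> {1..N} \<Longrightarrow> ?c (\<gamma> i) < (W2 Q (P i))\<^sup>2 + e / N"
    by metis
  have "N * (\<integral>y. (infdist y (averages N P))\<^sup>2 \<partial>Q) + total_second_moment - N * sup_mean_moment N P
      \<le> (\<Sum>i\<in>{1..N}. ?c (\<gamma> i))"
    by (rule coupling_costs_lower_bound[OF Q \<gamma>(1)])
  also have "\<dots> \<le> (\<Sum>i\<in>{1..N}. (W2 Q (P i))\<^sup>2 + e / N)"
    using \<gamma>(2) by (intro sum_mono) (auto intro: less_imp_le)
  also have "\<dots> = (\<Sum>i\<in>{1..N}. (W2 Q (P i))\<^sup>2) + e"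
    using N by (simp add: sum.distrib)
  finally show "N * (\<integral>y. (infdist y (averages N P))\<^sup>2 \<partial>Q) + total_second_moment - N * sup_mean_moment N P
      \<le> (\<Sum>i\<in>{1..N}. (W2 Q (P i))\<^sup>2) + e" .
qed

end

section \<open>Optimal averages and barycenters\<close>

theorem proposition1:
  fixes N :: nat and P :: "nat \<Rightarrow> (real ^ 'd) measure"
  assumes "N \<ge> 1" and "\<And>i. i \<in> {1..N} \<Longrightarrow> discrete_measure (P i)"
  shows "(\<exists>(M :: (nat \<Rightarrow> real ^ 'd) measure) X.
            coupled_vector N P M X \<and> mean_moment N M X = sup_mean_moment N P)
       \<and> (\<forall>(M :: 'w measure) X.
            coupled_vector N P M X \<and> mean_moment N M X = sup_mean_moment N P \<longrightarrow>
              supp (mean_law N M X) \<subseteq> averages N P \<and>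
              (\<Sum>i\<in>{1..N}. (W2 (mean_law N M X) (P i))\<^sup>2)
                = (INF Q\<in>P2. \<Sum>i\<in>{1..N}. (W2 Q (P i))\<^sup>2) \<and>
              (INF Q\<in>P2. \<Sum>i\<in>{1..N}. (W2 Q (P i))\<^sup>2)
                = (INF Q\<in>P2_on (averages N P). \<Sum>i\<in>{1..N}. (W2 Q (P i))\<^sup>2))
       \<and> (\<forall>Q. is_arg_min (\<lambda>R. \<Sum>i\<in>{1..N}. (W2 R (P i))\<^sup>2) (\<lambda>R. R \<in> P2) Q \<longrightarrow>
              supp Q \<subseteq> averages N P)"
proof -
  interpret discrete_marginals N P using assms by unfold_locales auto
  let ?S = "averages N P" and ?F = "\<lambda>R. \<Sum>i\<in>{1..N}. (W2 R (P i))\<^sup>2"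
  let ?m = "total_second_moment - N * sup_mean_moment N P"
  have lower: "?m \<le> ?F Q" if "Q \<in> P2" for Q
  proof -
    have "0 \<le> N * (\<integral>y. (infdist y ?S)\<^sup>2 \<partial>Q)" by simp
    then show ?thesis using sum_W2_squared_lower_bound[OF that] by linarith
  qed
  have ii: "supp (mean_law N M X) \<subseteq> ?S \<and> ?F (mean_law N M X) = (INF Q\<in>P2. ?F Q) \<and>
      (INF Q\<in>P2. ?F Q) = (INF Q\<in>P2_on ?S. ?F Q)"
    if vec: "coupled_vector N P M X" and opt: "mean_moment N M X = sup_mean_moment N P"
    for M :: "'w measure" and X
  proof -
    note L = mean_law_in_P2[OF vec] supp_mean_law_subset[OF vec] sum_W2_mean_law_le[OF vec]
    have F: "?F (mean_law N M X) = ?m" using L(3) lower[OF L(1)] unfolding opt by simp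
    have "(INF Q\<in>P2. ?F Q) = ?m"
      using lower L(1) F by (intro cInf_eq_minimum) (auto intro: rev_image_eqI)
    moreover have "(INF Q\<in>P2_on ?S. ?F Q) = ?m"
      using lower L(1,2) F by (intro cInf_eq_minimum) (auto simp: P2_on_def intro: rev_image_eqI)
    ultimately show ?thesis using L(2) F by simp
  qed
  \<comment> \<open>A minimiser costs no more than the law of an optimal average, which leaves no room for the
    distance term in the lower bound.\<close>
  have iii: "supp Q \<subseteq> ?S" if "is_arg_min ?F (\<lambda>R. R \<in> P2) Q" for Q
  proof -
    have Q: "Q \<in> P2" and min: "\<And>R. R \<in> P2 \<Longrightarrow> ?F Q \<le> ?F R"
      using that by (auto simp: is_arg_min_linorder)
    obtain M :: "(nat \<Rightarrow> real ^ 'd) measure" and X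
      where vec: "coupled_vector N P M X" and opt: "mean_moment N M X = sup_mean_moment N P"
      using sup_mean_moment_attained by blast
    have "?F Q \<le> ?m"
      using min[OF mean_law_in_P2[OF vec]] sum_W2_mean_law_le[OF vec] unfolding opt by linarith
    then have "N * (\<integral>y. (infdist y ?S)\<^sup>2 \<partial>Q) \<le> 0"
      using sum_W2_squared_lower_bound[OF Q] by linarith
    then have "(\<integral>y. (infdist y ?S)\<^sup>2 \<partial>Q) = 0"
      using N by (intro antisym) (auto simp: mult_le_0_iff)
    then have "AE y in Q. (infdist y ?S)\<^sup>2 = 0"
      using integral_nonneg_eq_0_iff_AE[OF integrable_infdist_averages[OF Q]] by simp
    moreover have "closed ?S" using finite_averages by (rule finite_imp_closed)
    ultimately show ?thesis
      using Q averages_nonempty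
      by (intro supp_subset_closed) (auto simp: P2_def in_closed_iff_infdist_zero)
  qed
  show ?thesis using sup_mean_moment_attained ii iii by blast
qed

end
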